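(* Let $(\mathcal A,\circ)$ be a finite-dimensional $\delta$-mock-Novikov algebra over a field $\mathbb F$ of characteristic zero, where $\delta\in\mathbb F$, $\delta\neq0$. Then $\mathcal A$ is nilpotent.
   Context: An algebra is a vector space with a bilinear product, not necessarily associative. A $\delta$-mock-Novikov algebra is an algebra $(\mathcal A,\circ)$ such that for all $a,b,c\in\mathcal A$ $$\delta(a\circ b)\circ c+\delta(b\circ a)\circ c+a\circ(b\circ c)+b\circ(a\circ c)=0,\qquad (a\circ b)\circ c+(a\circ c)\circ b=0.$$ For subspaces $\mathcal U,\mathcal V\subseteq\mathcal A$ put $\mathcal U\circ\mathcal V=\operatorname{span}\{u\circ v\mid u\in\mathcal U,v\in\mathcal V\}$. Define $\mathcal A^1=\mathcal A$ and $\mathcal A^n=\sum_{i=1}^{n-1}\mathcal A^i\circ\mathcal A^{n-i}$ for $n\ge2$. The algebra $\mathcal A$ is nilpotent if $\mathcal A^N=0$ for some integer $N\ge2$. *)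

theory Defs
  imports Complex_Main "HOL-Library.Set_Algebras"
begin

locale nonassoc_algebra = vector_space scale
  for scale :: "'f::field \<Rightarrow> 'a::ab_group_add \<Rightarrow> 'a" (infixr "*s" 75) +
  fixes mult :: "'a \<Rightarrow> 'a \<Rightarrow> 'a" (infixl "\<odot>" 70)
  assumes linear_mult_left: "\<And>b. Vector_Spaces.linear (*s) (*s) (\<lambda>a. a \<odot> b)"
    and linear_mult_right: "\<And>a. Vector_Spaces.linear (*s) (*s) (\<lambda>b. a \<odot> b)"
begin

definition subspace_mult :: "'a set \<Rightarrow> 'a set \<Rightarrow> 'a set" where
  "subspace_mult U V = span {u \<odot> v | u v. u \<in> U \<and> v \<in> V}"

text \<open>
  The sum below is the elementwise sum of sets from \<^theory>\<open>HOL-Library.Set_Algebras\<close>,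
  which on subspaces is the sum of subspaces. Only exponents \<open>n \<ge> 1\<close> are meaningful;
  exponent \<open>0\<close> gets the dummy value \<^term>\<open>UNIV\<close> and does not occur in the sum.
\<close>
function algebra_power :: "nat \<Rightarrow> 'a set" where
  "algebra_power n =
    (if n \<le> 1 then UNIV
     else (\<Sum>i\<in>{1..<n}. subspace_mult (algebra_power i) (algebra_power (n - i))))"
  by auto
termination by (relation "measure id") auto

declare algebra_power.simps [simp del]

definition nilpotent :: bool where
  "nilpotent \<longleftrightarrow> (\<exists>N\<ge>2. algebra_power N = {0})"

end

locale mock_novikov_algebra = nonassoc_algebra scale mult
  for scale :: "'f::field \<Rightarrow> 'a::ab_group_add \<Rightarrow> 'a" (infixr "*s" 75)
    and mult :: "'a \<Rightarrow> 'a \<Rightarrow> 'a" (infixl "\<odot>" 70) +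
  fixes \<delta> :: 'f
  assumes mock_left_symmetry:
      "\<And>a b c. \<delta> *s ((a \<odot> b) \<odot> c) + \<delta> *s ((b \<odot> a) \<odot> c)
        + a \<odot> (b \<odot> c) + b \<odot> (a \<odot> c) = 0"
    and right_anticommutativity: "\<And>a b c. (a \<odot> b) \<odot> c + (a \<odot> c) \<odot> b = 0"

end

(*
  Modulo any proper ideal I, right multiplications pairwise anticommute, and a finite family of
  anticommuting operators (in characteristic not 2) has a common kernel vector; so the left
  annihilator W of the algebra modulo I is not contained in I. Since \<delta> \<noteq> 0, the first identity
  makes W stable under left multiplications and forces A^2 to annihilate W from the left modulo I;
  hence the left multiplications anticommute on W as well and W contains a vector outside I that
  is annihilated from both sides. So the upper central series is strictly increasing until it
  reaches the whole algebra.
*)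
theory Submission
  imports Defs
begin

text \<open>Induction on \<open>B\<close>: if \<open>w\<close> works for \<open>B\<close> but
  \<open>T b w\<close> is outside \<open>I\<close>, replace \<open>w\<close> by
  \<open>T b w\<close>. Anticommutation carries the vanishing for \<open>B\<close> over to the new
  vector, and taking both operators equal to \<open>T b\<close> gives twice
  \<open>T b (T b w)\<close> in \<open>I\<close>, hence the halving assumption. Stating everything
  modulo \<open>I\<close> avoids quotient spaces.\<close>

lemma anticommuting_common_kernel:
  fixes T :: "'b \<Rightarrow> 'a \<Rightarrow> 'a::ab_group_add"
  assumes "finite B" and "v \<in> W" and "v \<notin> I"
    and diff: "\<And>x y. x \<in> I \<Longrightarrow> y \<in> I \<Longrightarrow> x - y \<in> I"
    and halve: "\<And>x. x + x \<in> I \<Longrightarrow> x \<in> I"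
    and W: "\<And>b w. w \<in> W \<Longrightarrow> T b w \<in> W"
    and I: "\<And>b w. w \<in> I \<Longrightarrow> T b w \<in> I"
    and anticomm: "\<And>b c w. w \<in> W \<Longrightarrow> T b (T c w) + T c (T b w) \<in> I"
  shows "\<exists>w\<in>W. w \<notin> I \<and> (\<forall>b\<in>B. T b w \<in> I)"
  using \<open>finite B\<close>
proof induction
  case empty
  then show ?case using assms(2,3) by auto
next
  case (insert b B)
  then obtain w where w: "w \<in> W" "w \<notin> I" "\<forall>c\<in>B. T c w \<in> I" by auto
  show ?case
  proof (cases "T b w \<in> I")
    case True
    then show ?thesis using w by auto
  next
    case False
    have "T c (T b w) \<in> I" if "c \<in> B" for c
      using diff[OF anticomm[OF w(1), of c b] I[of "T c w" b]] w(3) that by simp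
    moreover have "T b (T b w) \<in> I"
      by (rule halve[OF anticomm[OF w(1)]])
    ultimately show ?thesis using False W[OF w(1)] by blast
  qed
qed

context nonassoc_algebra
begin

lemma mult_add_left: "(a + b) \<odot> c = a \<odot> c + b \<odot> c"
  and mult_scale_left: "(r *s a) \<odot> c = r *s (a \<odot> c)"
  and mult_zero_left: "0 \<odot> c = 0"
proof -
  interpret l: Vector_Spaces.linear scale scale "\<lambda>a. a \<odot> c" by (rule linear_mult_left)
  show "(a + b) \<odot> c = a \<odot> c + b \<odot> c" "(r *s a) \<odot> c = r *s (a \<odot> c)" "0 \<odot> c = 0"
    by (rule l.add l.scale l.zero)+
qed

lemma mult_add_right: "a \<odot> (b + c) = a \<odot> b + a \<odot> c"
  and mult_scale_right: "a \<odot> (r *s b) = r *s (a \<odot> b)"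
  and mult_zero_right: "a \<odot> 0 = 0"
proof -
  interpret l: Vector_Spaces.linear scale scale "\<lambda>b. a \<odot> b" by (rule linear_mult_right)
  show "a \<odot> (b + c) = a \<odot> b + a \<odot> c" "a \<odot> (r *s b) = r *s (a \<odot> b)" "a \<odot> 0 = 0"
    by (rule l.add l.scale l.zero)+
qed

definition ideal :: "'a set \<Rightarrow> bool" where
  "ideal I \<longleftrightarrow> subspace I \<and> (\<forall>v\<in>I. \<forall>a. a \<odot> v \<in> I \<and> v \<odot> a \<in> I)"

text \<open>For an ideal \<open>I\<close>, this is the preimage of the two-sided annihilator of the
  quotient algebra by \<open>I\<close>.\<close>

definition annihilator_mod :: "'a set \<Rightarrow> 'a set" where
  "annihilator_mod I = {v. \<forall>a. a \<odot> v \<in> I \<and> v \<odot> a \<in> I}"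

primrec upper_central :: "nat \<Rightarrow> 'a set" where
  "upper_central 0 = {0}"
| "upper_central (Suc n) = annihilator_mod (upper_central n)"

lemma subspace_annihilator_mod: "subspace I \<Longrightarrow> subspace (annihilator_mod I)"
  by (auto simp: subspace_def annihilator_mod_def mult_add_left mult_add_right mult_scale_left
      mult_scale_right mult_zero_left mult_zero_right)

lemma ideal_annihilator_mod: "ideal I \<Longrightarrow> ideal (annihilator_mod I)"
  using subspace_annihilator_mod by (auto simp: ideal_def annihilator_mod_def)

lemma ideal_subset_annihilator_mod: "ideal I \<Longrightarrow> I \<subseteq> annihilator_mod I"
  by (auto simp: ideal_def annihilator_mod_def)

lemma ideal_upper_central: "ideal (upper_central n)"
proof (induction n)
  case 0
  then show ?case by (simp add: ideal_def mult_zero_left mult_zero_right)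
qed (simp add: ideal_annihilator_mod)

lemma subspace_mult_subset:
  assumes "subspace I" and "U \<subseteq> annihilator_mod I \<or> V \<subseteq> annihilator_mod I"
  shows "subspace_mult U V \<subseteq> I"
  unfolding subspace_mult_def
  by (rule span_minimal) (use assms in \<open>auto simp: annihilator_mod_def\<close>)

lemma sum_sets_subset:
  assumes "subspace I" and "finite A" and "\<And>i. i \<in> A \<Longrightarrow> S i \<subseteq> I"
  shows "(\<Sum>i\<in>A. S i) \<subseteq> I"
  using assms(2,3)
proof (induction A)
  case empty
  then show ?case using subspace_0[OF assms(1)] by (simp add: set_zero)
next
  case (insert i A)
  then have "S i \<subseteq> I" "sum S A \<subseteq> I" by auto
  with insert.hyps show ?case using subspace_add[OF assms(1)] by (auto elim!: set_plus_elim)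
qed

text \<open>Turns an inclusion in \<open>{0}\<close> into the equality demanded by
  \<open>nilpotent\<close>.\<close>

lemma zero_in_algebra_power: "0 \<in> algebra_power n"
proof (cases "n \<le> 1")
  case True
  then show ?thesis by (subst algebra_power.simps) simp
next
  case False
  \<comment> \<open>The index set and both families are generalized so that induction on the finite
    set applies.\<close>
  have "0 \<in> (\<Sum>i\<in>A. subspace_mult (U i) (V i))" if "finite A" for A :: "nat set" and U V
    using that
  proof induction
    case (insert i A)
    have "0 \<in> subspace_mult (U i) (V i)"
      by (simp add: subspace_mult_def span_zero)
    then have "0 + 0 \<in> subspace_mult (U i) (V i) + (\<Sum>i\<in>A. subspace_mult (U i) (V i))"
      using insert.IH by (rule set_plus_intro)
    then show ?case using insert.hyps by simp
  qed (simp add: set_zero)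
  with False show ?thesis by (subst algebra_power.simps) simp
qed

text \<open>In a product of degree at least \<open>2 ^ Suc k\<close> one of the two factors has degree at
  least \<open>2 ^ k\<close>, so each doubling of the degree descends one step of the series.\<close>
lemma algebra_power_subset_upper_central:
  assumes "upper_central n = UNIV" and "k \<le> n" and "2 ^ k \<le> m"
  shows "algebra_power m \<subseteq> upper_central (n - k)"
  using assms(2,3)
proof (induction k arbitrary: m)
  case 0
  then show ?case using assms(1) by simp
next
  case (Suc k)
  define J where "J = upper_central (n - Suc k)"
  have J: "subspace J" "upper_central (n - k) = annihilator_mod J"
    using ideal_upper_central[of "n - Suc k"] Suc.prems(1)
    by (auto simp: J_def ideal_def Suc_diff_Suc simp flip: upper_central.simps)
  have "subspace_mult (algebra_power i) (algebra_power (m - i)) \<subseteq> J" for i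
  proof (rule subspace_mult_subset[OF J(1)])
    \<comment> \<open>True for every \<open>i\<close>, even beyond \<open>m\<close>: with truncated
      subtraction, \<open>i + (m - i) \<ge> m \<ge> 2 * 2 ^ k\<close>.\<close>
    have "2 ^ k \<le> i \<or> 2 ^ k \<le> m - i" using Suc.prems(2) by auto
    then show "algebra_power i \<subseteq> annihilator_mod J \<or> algebra_power (m - i) \<subseteq> annihilator_mod J"
      using Suc.IH Suc.prems(1) J(2) by auto
  qed
  then have "(\<Sum>i\<in>{1..<m}. subspace_mult (algebra_power i) (algebra_power (m - i))) \<subseteq> J"
    by (intro sum_sets_subset J(1)) auto
  moreover have "1 < m"
    using Suc.prems(2) one_le_power[of "2::nat" k] unfolding power_Suc by linarith
  ultimately show ?case by (subst algebra_power.simps) (simp add: J_def)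
qed

lemma nilpotent_if_upper_central_UNIV:
  assumes "upper_central n = UNIV"
  shows nilpotent
proof -
  \<comment> \<open>Degree \<open>2 ^ n\<close> already descends to \<open>upper_central 0\<close>;
    the extra factor 2 keeps the exponent at least 2 when \<open>n = 0\<close>.\<close>
  have "algebra_power (2 * 2 ^ n) \<subseteq> {0}"
    using algebra_power_subset_upper_central[OF assms, of n "2 * 2 ^ n"] by simp
  then show ?thesis
    unfolding nilpotent_def using zero_in_algebra_power by (intro exI[of _ "2 * 2 ^ n"]) auto
qed

end

context mock_novikov_algebra
begin

text \<open>Drives the strict growth of \<open>upper_central\<close>. The finite spanning set
  \<open>B\<close> reduces annihilation by all elements to finitely many operators.\<close>

lemma annihilator_mod_not_subset:
  assumes I: "ideal I" "I \<noteq> UNIV"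
    and B: "finite B" "span B = UNIV"
    and nz: "(2::'f) \<noteq> 0" "\<delta> \<noteq> 0"
  shows "\<not> annihilator_mod I \<subseteq> I"
proof -
  have sub: "subspace I" using I by (simp add: ideal_def)
  have left: "a \<odot> v \<in> I" and right: "v \<odot> a \<in> I" if "v \<in> I" for a v
    using I that by (auto simp: ideal_def)
  have cancel: "x \<in> I" if "r *s x \<in> I" "r \<noteq> 0" for r x
    using subspace_scale[OF sub that(1), of "inverse r"] that(2) by simp
  have halve: "x \<in> I" if "x + x \<in> I" for x
  proof (rule cancel[OF _ nz(1)])
    have "2 *s x = x + x"
      using scale_left_distrib[of 1 1 x] by simp
    then show "2 *s x \<in> I" using that by simp
  qed
  note diff = subspace_diff[OF sub]

  define W where "W = {v. \<forall>c. v \<odot> c \<in> I}"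
  obtain v where "v \<notin> I" using I(2) by auto
  have "\<exists>w\<in>UNIV. w \<notin> I \<and> (\<forall>c\<in>B. w \<odot> c \<in> I)"
  proof (rule anticommuting_common_kernel[OF B(1) UNIV_I \<open>v \<notin> I\<close>])
    show "a \<odot> b \<odot> c + a \<odot> c \<odot> b \<in> I" for a b c
      by (simp add: right_anticommutativity subspace_0[OF sub])
  qed (simp_all add: diff right, fact halve)
  then obtain w where w: "w \<notin> I" "\<forall>c\<in>B. w \<odot> c \<in> I" by auto
  \<comment> \<open>The elements that \<open>w\<close> multiplies into \<open>I\<close> form a
    subspace, so checking them on \<open>B\<close> suffices.\<close>
  have "span B \<subseteq> {c. w \<odot> c \<in> I}"
    using w(2) sub by (intro span_minimal)
      (auto simp: subspace_def mult_add_right mult_scale_right mult_zero_right)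
  then have "w \<in> W" using B(2) by (auto simp: W_def)

  \<comment> \<open>In the first identity at \<open>a, v, c\<close> the other three terms lie in
    \<open>I\<close>; dividing by \<open>\<delta>\<close> isolates this one. It says that
    \<open>W\<close> is stable under left multiplications.\<close>
  have av_c: "(a \<odot> v) \<odot> c \<in> I" if "v \<in> W" for a v c
  proof -
    have "v \<odot> a \<in> I" "v \<odot> c \<in> I" "v \<odot> (a \<odot> c) \<in> I" using that by (auto simp: W_def)
    then have "\<delta> *s ((v \<odot> a) \<odot> c) + a \<odot> (v \<odot> c) + v \<odot> (a \<odot> c) \<in> I"
      by (simp only: subspace_add[OF sub] subspace_scale[OF sub] left right)
    moreover have "\<delta> *s ((a \<odot> v) \<odot> c)
        = - (\<delta> *s ((v \<odot> a) \<odot> c) + a \<odot> (v \<odot> c) + v \<odot> (a \<odot> c))"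
      using mock_left_symmetry[of a v c] by (simp only: eq_neg_iff_add_eq_0 add.assoc)
    ultimately have "\<delta> *s ((a \<odot> v) \<odot> c) \<in> I" by (simp only: subspace_neg[OF sub])
    then show ?thesis using nz(2) by (rule cancel)
  qed
  have ac_v: "(a \<odot> c) \<odot> v \<in> I" if "v \<in> W" for a v c
  proof -
    have "(a \<odot> c) \<odot> v = - ((a \<odot> v) \<odot> c)"
      using right_anticommutativity[of a c v] by (simp only: eq_neg_iff_add_eq_0)
    then show ?thesis by (simp only: subspace_neg[OF sub] av_c[OF that])
  qed
  \<comment> \<open>By \<open>ac_v\<close> the \<open>\<delta>\<close>-terms of the first identity
    lie in \<open>I\<close>, leaving only the products of two left multiplications.\<close>
  have anticomm: "a \<odot> (b \<odot> v) + b \<odot> (a \<odot> v) \<in> I" if "v \<in> W" for a b v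
  proof -
    have "\<delta> *s ((a \<odot> b) \<odot> v) + \<delta> *s ((b \<odot> a) \<odot> v) \<in> I"
      by (intro subspace_add[OF sub] subspace_scale[OF sub] ac_v that)
    moreover have "a \<odot> (b \<odot> v) + b \<odot> (a \<odot> v)
        = - (\<delta> *s ((a \<odot> b) \<odot> v) + \<delta> *s ((b \<odot> a) \<odot> v))"
      using mock_left_symmetry[of a b v] by (simp only: eq_neg_iff_add_eq_0 ac_simps)
    ultimately show ?thesis by (simp only: subspace_neg[OF sub])
  qed
  have "\<exists>u\<in>W. u \<notin> I \<and> (\<forall>a\<in>B. a \<odot> u \<in> I)"
  proof (rule anticommuting_common_kernel[OF B(1) \<open>w \<in> W\<close> w(1)])
    show "a \<odot> v \<in> W" if "v \<in> W" for a v using av_c that by (simp add: W_def)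
  qed (fact diff halve left anticomm)+
  then obtain u where u: "u \<in> W" "u \<notin> I" "\<forall>a\<in>B. a \<odot> u \<in> I" by auto
  have "span B \<subseteq> {a. a \<odot> u \<in> I}"
    using u(3) sub by (intro span_minimal)
      (auto simp: subspace_def mult_add_left mult_scale_left mult_zero_left)
  then have "u \<in> annihilator_mod I" using B(2) u(1) by (auto simp: annihilator_mod_def W_def)
  with u(2) show ?thesis by auto
qed

end

theorem theorem4p5:
  fixes scale :: "'f::field_char_0 \<Rightarrow> 'a::ab_group_add \<Rightarrow> 'a"
    and mult :: "'a \<Rightarrow> 'a \<Rightarrow> 'a"
    and \<delta> :: 'f
    and Basis :: "'a set"
  assumes "mock_novikov_algebra scale mult \<delta>"
    and "finite_dimensional_vector_space scale Basis"
    and "\<delta> \<noteq> 0"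
  shows "nonassoc_algebra.nilpotent scale mult"
proof -
  interpret mock_novikov_algebra scale mult \<delta> by fact
  interpret fd: finite_dimensional_vector_space scale Basis by fact
  \<comment> \<open>Each step below the whole algebra raises the dimension by at least one.\<close>
  have "upper_central n = UNIV \<or> n \<le> dim (upper_central n)" for n
  proof (induction n)
    case (Suc n)
    let ?Z = "upper_central n"
    have Z: "ideal ?Z" by (rule ideal_upper_central)
    show ?case
    proof (cases "?Z = UNIV")
      case True
      then show ?thesis by (simp add: annihilator_mod_def)
    next
      case False
      have "\<not> annihilator_mod ?Z \<subseteq> ?Z"
        using annihilator_mod_not_subset[OF Z False fd.finite_Basis fd.span_Basis] assms(3) by simp
      then have "span ?Z \<subset> span (annihilator_mod ?Z)"
        using Z ideal_annihilator_mod[OF Z] ideal_subset_annihilator_mod[OF Z]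
        unfolding ideal_def by (metis span_eq_iff psubsetI)
      then have "dim ?Z < dim (annihilator_mod ?Z)" by (rule fd.dim_psubset)
      with Suc False show ?thesis by simp
    qed
  qed simp
  \<comment> \<open>One more step than the dimension rules out the second alternative.\<close>
  from this[of "Suc fd.dimension"] have "upper_central (Suc fd.dimension) = UNIV"
    using fd.dim_subset_UNIV[of "upper_central (Suc fd.dimension)"] by linarith
  then show ?thesis by (rule nilpotent_if_upper_central_UNIV)
qed

end
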